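(* Let $B_1(0)\subset\mathbb{R}^d$ be the $d$-dimensional unit ball, $d\ge2$. There exists a constant $c_d>0$ depending only on $d$ such that for every $\varepsilon>0$ there exists a vector field $V_\varepsilon\in L^{\frac{d}{d-1}}(B_1(0);\mathbb{R}^d)$ such that $\operatorname{div}V_\varepsilon\ge0$ and $\operatorname{div}V_\varepsilon\in L^1(B_1(0))$ (thus, in particular, $\operatorname{div}V_\varepsilon\ll\mathcal{L}^d$), but $$\operatorname{div}V_\varepsilon(B_\delta(0))=c_d\,\delta^\varepsilon\qquad\forall\,0<\delta<1.$$
   Context: The divergence is taken in the sense of distributions on $B_1(0)$; $\operatorname{div}V_\varepsilon$, being a nonnegative $L^1$ function, is identified with the measure having it as density with respect to the $d$-dimensional Lebesgue measure $\mathcal{L}^d$, so $\operatorname{div}V_\varepsilon(B_\delta(0))=\int_{B_\delta(0)}\operatorname{div}V_\varepsilon\,dx$. *)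

theory Defs
  imports "HOL-Analysis.Analysis"
begin

definition partial_deriv :: "'n::finite \<Rightarrow> (real^'n \<Rightarrow> real) \<Rightarrow> real^'n \<Rightarrow> real" where
  "partial_deriv i \<phi> x = frechet_derivative \<phi> (at x) (axis i 1)"

definition grad :: "(real^'n::finite \<Rightarrow> real) \<Rightarrow> real^'n \<Rightarrow> real^'n" where
  "grad \<phi> x = (\<chi> i. partial_deriv i \<phi> x)"

(* Requiring differentiability at every point in the successor case ensures that
   frechet_derivative is a genuine derivative there; the case 0 makes all partial
   derivatives up to the given order continuous. *)
primrec C_k :: "nat \<Rightarrow> (real^'n::finite \<Rightarrow> real) \<Rightarrow> bool" where
  "C_k 0 \<phi> \<longleftrightarrow> continuous_on UNIV \<phi>"
| "C_k (Suc k) \<phi> \<longleftrightarrow> (\<forall>x. \<phi> differentiable (at x)) \<and> (\<forall>i. C_k k (partial_deriv i \<phi>))"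

(* Smooth functions with compact support in U, each represented by its extension
   by zero to the whole space. *)
definition test_functions :: "(real^'n::finite) set \<Rightarrow> (real^'n \<Rightarrow> real) set" where
  "test_functions U =
     {\<phi>. (\<forall>k. C_k k \<phi>) \<and> compact (closure {x. \<phi> x \<noteq> 0}) \<and> closure {x. \<phi> x \<noteq> 0} \<subseteq> U}"

(* Functions are not identified almost everywhere; intended for 1 \<le> p < \<infinity>. *)
definition Lp_fields :: "real \<Rightarrow> (real^'n::finite) set \<Rightarrow> (real^'n \<Rightarrow> real^'n) set" where
  "Lp_fields p U =
     {V. V \<in> borel_measurable (lebesgue_on U) \<and>
         integrable (lebesgue_on U) (\<lambda>x. norm (V x) powr p)}"

definition distr_div ::
    "(real^'n::finite) set \<Rightarrow> (real^'n \<Rightarrow> real^'n) \<Rightarrow> (real^'n \<Rightarrow> real) \<Rightarrow> real" where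
  "distr_div U V \<phi> = - integral\<^sup>L (lebesgue_on U) (\<lambda>x. V x \<bullet> grad \<phi> x)"

(* The distributional divergence of V on U is the function f. Meaningful for U open and
   V, f locally integrable on U: otherwise the Bochner integrals may default to 0. *)
definition has_distr_div ::
    "(real^'n::finite \<Rightarrow> real^'n) \<Rightarrow> (real^'n \<Rightarrow> real) \<Rightarrow> (real^'n) set \<Rightarrow> bool" where
  "has_distr_div V f U \<longleftrightarrow>
     (\<forall>\<phi> \<in> test_functions U. distr_div U V \<phi> = integral\<^sup>L (lebesgue_on U) (\<lambda>x. f x * \<phi> x))"

end

theory Submission
  imports Defs
begin

text \<open>
  With \<open>d\<close> the dimension, the field is a constant multiple of \<open>\<bar>x\<bar> powr (\<epsilon> - d) x\<close>. Its divergence is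
  the corresponding multiple of \<open>\<epsilon> \<bar>x\<bar> powr (\<epsilon> - d)\<close>, which is positive and homogeneous of degree
  \<open>\<epsilon> - d\<close>, so its integral over the ball of radius \<open>\<delta>\<close> is proportional to \<open>\<delta> powr \<epsilon>\<close>.
  Dividing by the integral over the unit ball makes the constant equal to \<open>1\<close> in every dimension and
  for every \<open>\<epsilon>\<close>. Both the divergence and the power \<open>d / (d - 1)\<close> of the norm of the field are
  multiples of a power of \<open>\<bar>x\<bar>\<close> with exponent above \<open>- d\<close>, hence integrable
  (\<open>integrable_norm_powr_unit_ball\<close>).

  Everything rests on the behaviour of Lebesgue measure under dilations
  (\<open>integral_lborel_dilation\<close>), which also yields the divergence: for a test function \<open>\<phi>\<close> the
  integral \<open>G t\<close> of \<open>\<bar>x\<bar> powr p * \<phi> (t x)\<close> equals \<open>t powr (- p - d) * G 1\<close>. Differentiating at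
  \<open>t = 1\<close> gives on one side the integral of \<open>\<bar>x\<bar> powr p * (x \<bullet> grad \<phi> x)\<close> and on the other
  \<open>- (p + d) * G 1\<close>: this is the weak formula for the divergence of \<open>\<bar>x\<bar> powr p x\<close>, the
  singularity at the origin included (\<open>integral_norm_powr_radial_derivative\<close>).
\<close>

section \<open>Dilations and radial powers\<close>

lemma integral_lborel_dilation:
  fixes f :: "'a::euclidean_space \<Rightarrow> real"
  assumes [measurable]: "f \<in> borel_measurable borel" and "0 < t"
  shows "(\<integral>x. f (t *\<^sub>R x) \<partial>lborel) = t powr (- real DIM('a)) * (\<integral>x. f x \<partial>lborel)"
proof -
  have "(\<integral>x. f x \<partial>lborel)
      = (\<integral>x. f x \<partial>density (distr lborel borel (\<lambda>x::'a. 0 + t *\<^sub>R x)) (\<lambda>_. ennreal (t ^ DIM('a))))"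
    using lborel_affine[of t "0::'a"] \<open>0 < t\<close> by (simp add: ennreal_power)
  also have "\<dots> = t ^ DIM('a) * (\<integral>x. f (t *\<^sub>R x) \<partial>lborel)"
    using \<open>0 < t\<close> by (simp add: integral_density integral_distr)
  finally show ?thesis
    using \<open>0 < t\<close> by (simp add: powr_minus powr_realpow field_simps)
qed

lemma borel_measurable_indicator_ball [measurable]:
  "(indicator (ball c r) :: 'a::euclidean_space \<Rightarrow> 'b::{second_countable_topology, t2_space, zero_neq_one}) \<in> borel_measurable borel"
  by (intro borel_measurable_indicator) simp

lemma dyadic_shell:
  fixes r :: real
  assumes "0 < r" "r < 1"
  obtains k where "(1/2) ^ Suc k \<le> r" "r < (1/2) ^ k"
proof -
  obtain n where "(1/2) ^ n < r"
    using real_arch_pow_inv[OF \<open>0 < r\<close>, of "1/2"] by auto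
  then have "(1/2) ^ n \<le> r" by (rule less_imp_le)
  moreover have "\<not> (1/2) ^ 0 \<le> r" using \<open>r < 1\<close> by simp
  ultimately obtain k where "\<not> (1/2) ^ k \<le> r" "(1/2) ^ Suc k \<le> r"
    using ex_least_nat_less[of "\<lambda>n. (1/2) ^ n \<le> r" n] by blast
  then show ?thesis by (intro that[of k]) (simp_all only: not_le)
qed

text \<open>
  On the shell where \<open>\<bar>x\<bar>\<close> lies between \<open>2^-(k+1)\<close> and \<open>2^-k\<close> the function is comparable to
  \<open>2^-(k p)\<close>, and the ball of radius \<open>2^-k\<close> has volume proportional to \<open>2^-(k d)\<close>. The integral is
  thus dominated by a geometric series of ratio \<open>2^-(p + d) < 1\<close>.
\<close>

lemma integrable_norm_powr_unit_ball:
  fixes p :: real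
  assumes p: "- real DIM('a) < p"
  shows "integrable lborel (\<lambda>x::'a::euclidean_space. indicator (ball 0 1) x * norm x powr p)"
proof (rule integrableI_nonneg)
  define q :: real where "q = (1/2) powr p"
  \<comment> \<open>The two entries serve \<open>p \<ge> 0\<close> and \<open>p < 0\<close>, where the power is largest at the outer and at the
    inner radius of a shell respectively.\<close>
  define C :: real where "C = max 1 q"
  define w where "w = measure lborel (ball (0::'a) 1)"
  have q: "0 < q" and C: "0 < C" by (auto simp: q_def C_def)
  have pointwise: "ennreal (indicator (ball 0 1) x * norm x powr p)
      \<le> (\<Sum>k. ennreal (C * q ^ k) * indicator (ball 0 ((1/2) ^ k)) x)" for x :: 'a
  proof (cases "x \<in> ball 0 1 \<and> x \<noteq> 0")
    case True
    then obtain k where k: "(1/2) ^ Suc k \<le> norm x" "norm x < (1/2) ^ k"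
      using dyadic_shell[of "norm x"] by auto
    have qk: "((1/2) ^ j) powr p = q ^ j" for j
      by (simp add: q_def powr_power powr_realpow[symmetric] powr_powr mult.commute)
    have "norm x powr p \<le> C * q ^ k"
    proof (cases "0 \<le> p")
      case True
      then have "norm x powr p \<le> q ^ k"
        unfolding qk[symmetric] using k by (intro powr_mono2) auto
      also have "\<dots> \<le> C * q ^ k" using q by (auto simp: C_def)
      finally show ?thesis .
    next
      case False
      then have "norm x powr p \<le> q ^ Suc k"
        unfolding qk[symmetric] using k by (intro powr_mono2') auto
      also have "\<dots> \<le> C * q ^ k" using q by (auto simp: C_def)
      finally show ?thesis .
    qed
    then have "ennreal (indicator (ball 0 1) x * norm x powr p)
        \<le> ennreal (C * q ^ k) * indicator (ball 0 ((1/2) ^ k)) x"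
      using True k by (auto intro: ennreal_leI)
    also have "\<dots> \<le> (\<Sum>k. ennreal (C * q ^ k) * indicator (ball 0 ((1/2) ^ k)) x)"
      using sum_le_suminf[OF summableI, of "{k}" "\<lambda>k. ennreal (C * q ^ k) * indicator (ball 0 ((1/2) ^ k)) x"]
      by (simp del: sum_mult_indicator)
    finally show ?thesis .
  qed auto
  have vol: "emeasure lborel (ball (0::'a) ((1/2) ^ k)) = ennreal (w * ((1/2) ^ DIM('a)) ^ k)" for k
    unfolding w_def by (simp add: emeasure_ball content_ball ennreal_mult' power_mult[symmetric] mult.commute)
  have ratio: "q * (1/2) ^ DIM('a) = (1/2) powr (p + real DIM('a))"
    by (simp add: q_def powr_add powr_realpow)
  have ratio1: "q * (1/2) ^ DIM('a) < 1"
    unfolding ratio using p by (subst powr01_less_one) auto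
  have "(\<integral>\<^sup>+x. ennreal (indicator (ball (0::'a) 1) x * norm x powr p) \<partial>lborel)
      \<le> (\<integral>\<^sup>+x. (\<Sum>k. ennreal (C * q ^ k) * indicator (ball (0::'a) ((1/2) ^ k)) x) \<partial>lborel)"
    by (intro nn_integral_mono pointwise)
  also have "\<dots> = (\<Sum>k. \<integral>\<^sup>+x. ennreal (C * q ^ k) * indicator (ball (0::'a) ((1/2) ^ k)) x \<partial>lborel)"
    by (intro nn_integral_suminf) simp
  also have "\<dots> = (\<Sum>k. ennreal (C * w * (q * (1/2) ^ DIM('a)) ^ k))"
    using q C by (simp add: nn_integral_cmult_indicator vol ennreal_mult'[symmetric] w_def
        power_mult_distrib ac_simps)
  also have "\<dots> < \<infinity>"
    using q C ratio1
    by (simp add: less_top[symmetric] w_def ennreal_suminf_neq_top summable_mult summable_geometric)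
  finally show "(\<integral>\<^sup>+x. ennreal (indicator (ball (0::'a) 1) x * norm x powr p) \<partial>lborel) < \<infinity>" .
qed auto

lemma integral_norm_powr_ball:
  fixes p r :: real
  assumes "0 < r"
  shows "(\<integral>x. indicator (ball (0::'a) r) x * norm x powr p \<partial>lborel)
       = r powr (p + real DIM('a)) *
         (\<integral>x. indicator (ball (0::'a::euclidean_space) 1) x * norm x powr p \<partial>lborel)"
proof -
  let ?J = "\<integral>x. indicator (ball (0::'a) r) x * norm x powr p \<partial>lborel"
  have "r powr (- real DIM('a)) * ?J
      = (\<integral>x. indicator (ball (0::'a) r) (r *\<^sub>R x) * norm (r *\<^sub>R x) powr p \<partial>lborel)"
    using \<open>0 < r\<close> by (intro integral_lborel_dilation[symmetric]) auto
  also have "\<dots> = (\<integral>x. r powr p * (indicator (ball (0::'a) 1) x * norm x powr p) \<partial>lborel)"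
    using \<open>0 < r\<close> by (intro Bochner_Integration.integral_cong) (auto simp: indicator_def powr_mult)
  finally show ?thesis
    using \<open>0 < r\<close> by (simp add: powr_add powr_minus field_simps)
qed

lemma integral_norm_powr_unit_ball_pos:
  assumes "- real DIM('a) < p"
  shows "0 < (\<integral>x. indicator (ball (0::'a::euclidean_space) 1) x * norm x powr p \<partial>lborel)"
proof -
  let ?f = "\<lambda>x::'a. indicator (ball 0 1) x * norm x powr p"
  have "(\<integral>x. ?f x \<partial>lborel) \<noteq> 0"
  proof
    assume "(\<integral>x. ?f x \<partial>lborel) = 0"
    then have "AE x in lborel. ?f x = 0"
      using integral_nonneg_eq_0_iff_AE[OF integrable_norm_powr_unit_ball[OF assms]] by auto
    moreover have "AE x in lborel. x \<noteq> (0::'a)"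
      by (rule AE_lborel_singleton)
    ultimately have "AE x in lborel. x \<notin> ball (0::'a) 1"
      by eventually_elim (auto simp: indicator_def split: if_splits)
    then have "emeasure lborel (ball (0::'a) 1) = 0"
      using AE_iff_measurable[of "ball (0::'a) 1" lborel "\<lambda>x. x \<notin> ball 0 1"]
      by (simp add: ball_def)
    then show False
      using content_ball_gt_0_iff[of "0::'a" 1] by (simp add: measure_def)
  qed
  moreover have "0 \<le> (\<integral>x. ?f x \<partial>lborel)" by simp
  ultimately show ?thesis by linarith
qed

section \<open>Euler's identity for homogeneous functions in weak form\<close>

text \<open>
  The points approach \<open>1\<close> from above since they serve as dilation factors: if \<open>\<phi>\<close> is supported in
  the unit ball and \<open>t \<ge> 1\<close>, then \<open>\<phi> (t x)\<close> as a function of \<open>x\<close> is supported there too.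
\<close>

lemma derivative_at_1_LIMSEQ:
  fixes f :: "real \<Rightarrow> real"
  assumes "(f has_real_derivative D) (at 1)"
  shows "(\<lambda>n. real (Suc n) * (f (1 + inverse (real (Suc n))) - f 1)) \<longlonglongrightarrow> D"
proof -
  have "((\<lambda>h. (f (1 + h) - f 1) / h) \<longlongrightarrow> D) (at 0)"
    using assms by (simp add: DERIV_def)
  moreover have "filterlim (\<lambda>n. inverse (real (Suc n))) (at 0) sequentially"
    unfolding filterlim_at using LIMSEQ_inverse_real_of_nat by (auto intro: always_eventually)
  ultimately have "(\<lambda>n. (f (1 + inverse (real (Suc n))) - f 1) / inverse (real (Suc n))) \<longlonglongrightarrow> D"
    by (rule filterlim_compose)
  then show ?thesis by (simp add: divide_inverse mult.commute)
qed

text \<open>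
  The left-hand side is the derivative at \<open>t = 1\<close> of the integral \<open>G t\<close> of
  \<open>\<bar>x\<bar> powr p * \<phi> (t x)\<close>: the difference quotients of \<open>\<phi>\<close> in \<open>t\<close> are bounded by the Lipschitz
  constant, so dominated convergence applies. The right-hand side is the same derivative read off from
  the scaling law \<open>G t = t powr (- p - d) * G 1\<close>. The Lipschitz bound is required on the ball of
  radius \<open>2\<close> since the dilated points \<open>t x\<close> with \<open>t \<le> 2\<close> leave the unit ball.
\<close>

lemma integral_norm_powr_radial_derivative:
  fixes \<phi> D :: "'a::euclidean_space \<Rightarrow> real"
  assumes p: "- real DIM('a) < p"
    and [measurable]: "\<phi> \<in> borel_measurable borel"
    and lip: "M-lipschitz_on (cball 0 2) \<phi>"
    and zero: "\<And>x. 1 \<le> norm x \<Longrightarrow> \<phi> x = 0"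
    and D: "\<And>x. ((\<lambda>t. \<phi> (t *\<^sub>R x)) has_real_derivative D x) (at 1)"
  shows "(\<integral>x. indicator (ball 0 1) x * (norm x powr p * D x) \<partial>lborel)
       = - (p + real DIM('a)) * (\<integral>x. indicator (ball 0 1) x * (norm x powr p * \<phi> x) \<partial>lborel)"
proof -
  define t :: "nat \<Rightarrow> real" where "t n = 1 + inverse (real (Suc n))" for n
  define G where "G s = (\<integral>x. indicator (ball 0 1) x * (norm x powr p * \<phi> (s *\<^sub>R x)) \<partial>lborel)" for s
  define w where "w = (\<lambda>x::'a. M * (indicator (ball 0 1) x * norm x powr p))"
  define Q where "Q n x = indicator (ball 0 1) x *
      (norm x powr p * (real (Suc n) * (\<phi> (t n *\<^sub>R x) - \<phi> x)))" for n and x :: 'a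
  have t1: "1 \<le> t n" and t2: "t n \<le> 2" for n
    by (auto simp: t_def inverse_eq_divide)
  have M: "0 \<le> M" using lip by (rule lipschitz_on_nonneg)
  have D_lim: "(\<lambda>n. real (Suc n) * (\<phi> (t n *\<^sub>R x) - \<phi> x)) \<longlonglongrightarrow> D x" for x
    using derivative_at_1_LIMSEQ[OF D[of x]] by (simp add: t_def)
  have [measurable]: "D \<in> borel_measurable borel"
    by (rule borel_measurable_LIMSEQ_real[OF D_lim]) auto
  have w_int: "integrable lborel w"
    unfolding w_def by (intro integrable_mult_right integrable_norm_powr_unit_ball p)
  have Q_bound: "norm (Q n x) \<le> w x" for n x
  proof (cases "x \<in> ball 0 1")
    case True
    then have nx: "norm x < 1" by simp
    have "norm (t n *\<^sub>R x) \<le> 2"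
      using nx t1[of n] t2[of n] mult_mono[of "t n" 2 "norm x" 1] by simp
    then have "\<bar>\<phi> (t n *\<^sub>R x) - \<phi> x\<bar> \<le> M * norm (t n *\<^sub>R x - x)"
      using lipschitz_onD[OF lip, of "t n *\<^sub>R x" x] nx by (simp add: dist_norm)
    also have "t n *\<^sub>R x - x = inverse (real (Suc n)) *\<^sub>R x"
      by (simp add: t_def algebra_simps)
    finally have "real (Suc n) * \<bar>\<phi> (t n *\<^sub>R x) - \<phi> x\<bar> \<le> real (Suc n) * (M * norm (inverse (real (Suc n)) *\<^sub>R x))"
      by (intro mult_left_mono) auto
    also have "\<dots> = M * norm x" by simp
    also have "\<dots> \<le> M" using nx M by (simp add: mult_left_le)
    finally have "real (Suc n) * \<bar>\<phi> (t n *\<^sub>R x) - \<phi> x\<bar> \<le> M" .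
    then have "norm x powr p * (real (Suc n) * \<bar>\<phi> (t n *\<^sub>R x) - \<phi> x\<bar>) \<le> norm x powr p * M"
      by (intro mult_left_mono) auto
    then show ?thesis
      using True by (simp add: Q_def w_def abs_mult mult.commute)
  qed (simp add: Q_def w_def)
  have lim: "(\<lambda>n. \<integral>x. Q n x \<partial>lborel)
      \<longlonglongrightarrow> (\<integral>x. indicator (ball 0 1) x * (norm x powr p * D x) \<partial>lborel)"
  proof (rule integral_dominated_convergence[OF _ _ w_int])
    show "AE x in lborel. (\<lambda>n. Q n x) \<longlonglongrightarrow> indicator (ball 0 1) x * (norm x powr p * D x)"
      unfolding Q_def by (intro AE_I2 tendsto_intros D_lim)
    show "Q n \<in> borel_measurable lborel" for n
      unfolding Q_def[abs_def] by simp
  qed (use Q_bound in auto)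

  have G_int: "integrable lborel (\<lambda>x. indicator (ball 0 1) x * (norm x powr p * \<phi> (s *\<^sub>R x)))"
    if "1 \<le> s" "s \<le> 2" for s
  proof (rule Bochner_Integration.integrable_bound)
    show "integrable lborel (\<lambda>x::'a. (3 * M) * (indicator (ball 0 1) x * norm x powr p))"
      by (intro integrable_mult_right integrable_norm_powr_unit_ball p)
    show "AE x in lborel. norm (indicator (ball 0 1) x * (norm x powr p * \<phi> (s *\<^sub>R x)))
        \<le> norm ((3 * M) * (indicator (ball 0 1) x * norm x powr p))"
    proof (rule AE_I2)
      fix x :: 'a
      \<comment> \<open>The function vanishes at the unit vector \<open>b\<close>, which lies within distance \<open>3\<close> of \<open>s x\<close>.\<close>
      obtain b :: 'a where b: "norm b = 1" using vector_choose_size[of 1] by auto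
      have "\<bar>\<phi> (s *\<^sub>R x)\<bar> \<le> 3 * M" if x: "norm x < 1"
      proof -
        have "norm (s *\<^sub>R x) \<le> 2" using x \<open>1 \<le> s\<close> \<open>s \<le> 2\<close> mult_mono[of s 2 "norm x" 1] by simp
        then have "\<bar>\<phi> (s *\<^sub>R x) - \<phi> b\<bar> \<le> M * norm (s *\<^sub>R x - b)"
          using lipschitz_onD[OF lip, of "s *\<^sub>R x" b] b by (simp add: dist_norm)
        also have "\<dots> \<le> M * 3"
          using \<open>norm (s *\<^sub>R x) \<le> 2\<close> b norm_triangle_ineq4[of "s *\<^sub>R x" b] M
          by (intro mult_left_mono) auto
        finally show ?thesis using zero[of b] b by simp
      qed
      then show "norm (indicator (ball 0 1) x * (norm x powr p * \<phi> (s *\<^sub>R x)))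
        \<le> norm ((3 * M) * (indicator (ball 0 1) x * norm x powr p))"
        using M by (auto simp: indicator_def abs_mult mult.commute intro: mult_left_mono)
    qed
  qed simp

  have G_scale: "G s = s powr (- p - real DIM('a)) * G 1" if "1 \<le> s" for s
  proof -
    have "\<phi> (s *\<^sub>R x) = 0" if "1 \<le> norm x" for x
      using that \<open>1 \<le> s\<close> mult_mono[of 1 s 1 "norm x"] by (intro zero) auto
    then have full: "indicator (ball 0 1) x * (norm x powr p * \<phi> (s *\<^sub>R x))
        = s powr (- p) * (norm (s *\<^sub>R x) powr p * \<phi> (s *\<^sub>R x))" for x
      using \<open>1 \<le> s\<close> by (auto simp: indicator_def powr_mult powr_minus)
    have one: "G 1 = (\<integral>x. norm x powr p * \<phi> x \<partial>lborel)"
      unfolding G_def using zero by (intro Bochner_Integration.integral_cong) (auto simp: indicator_def)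
    have "G s = s powr (- p) * (\<integral>x. norm (s *\<^sub>R x) powr p * \<phi> (s *\<^sub>R x) \<partial>lborel)"
      unfolding G_def full by simp
    also have "\<dots> = s powr (- p) * (s powr (- real DIM('a)) * (\<integral>x. norm x powr p * \<phi> x \<partial>lborel))"
      using \<open>1 \<le> s\<close> by (subst integral_lborel_dilation[where f = "\<lambda>x. norm x powr p * \<phi> x"]) auto
    also have "\<dots> = s powr (- p - real DIM('a)) * G 1"
      by (simp only: one powr_add diff_conv_add_uminus mult.assoc)
    finally show ?thesis .
  qed
  have "(\<integral>x. Q n x \<partial>lborel) = real (Suc n) * (t n powr (- p - real DIM('a)) - 1) * G 1" for n
  proof -
    have "Q n = (\<lambda>x. real (Suc n) * (indicator (ball 0 1) x * (norm x powr p * \<phi> (t n *\<^sub>R x))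
        - indicator (ball 0 1) x * (norm x powr p * \<phi> (1 *\<^sub>R x))))"
      by (simp add: Q_def fun_eq_iff algebra_simps)
    then have "(\<integral>x. Q n x \<partial>lborel) = real (Suc n) * (G (t n) - G 1)"
      using G_int[of "t n"] G_int[of 1] t1[of n] t2[of n]
      by (simp add: G_def Bochner_Integration.integral_diff)
    then show ?thesis using G_scale[OF t1, of n] by (simp add: algebra_simps)
  qed
  moreover have "((\<lambda>s. s powr (- p - real DIM('a))) has_real_derivative (- p - real DIM('a))) (at 1)"
    by (auto intro!: derivative_eq_intros)
  then have "(\<lambda>n. real (Suc n) * (t n powr (- p - real DIM('a)) - 1) * G 1)
      \<longlonglongrightarrow> (- p - real DIM('a)) * G 1"
    using derivative_at_1_LIMSEQ[of "\<lambda>s. s powr (- p - real DIM('a))"]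
    unfolding t_def by (intro tendsto_intros) simp
  ultimately have "(\<lambda>n. \<integral>x. Q n x \<partial>lborel) \<longlonglongrightarrow> (- p - real DIM('a)) * G 1"
    by simp
  from LIMSEQ_unique[OF lim this] show ?thesis
    by (simp add: G_def algebra_simps)
qed

section \<open>Test functions\<close>

lemma C_1_gradient:
  fixes \<phi> :: "real^'n::finite \<Rightarrow> real"
  assumes "C_k 1 \<phi>"
  shows C_1_has_derivative: "(\<phi> has_derivative (\<lambda>v. grad \<phi> x \<bullet> v)) (at x)"
    and C_1_continuous_grad: "continuous_on UNIV (grad \<phi>)"
proof -
  have diff: "\<phi> differentiable (at x)"
    and cont: "\<And>i. continuous_on UNIV (partial_deriv i \<phi>)"
    using assms by (auto simp: One_nat_def)
  let ?D = "frechet_derivative \<phi> (at x)"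
  have D: "(\<phi> has_derivative ?D) (at x)"
    using diff by (simp add: frechet_derivative_works)
  interpret linear ?D using D by (rule has_derivative_linear)
  have "?D v = grad \<phi> x \<bullet> v" for v
  proof -
    have "?D v = ?D (\<Sum>i\<in>UNIV. v $ i *\<^sub>R axis i 1)"
      by (simp add: basis_expansion flip: scalar_mult_eq_scaleR)
    also have "\<dots> = (\<Sum>i\<in>UNIV. v $ i * partial_deriv i \<phi> x)"
      by (simp add: sum scale partial_deriv_def)
    finally show ?thesis by (simp add: grad_def inner_vec_def mult.commute)
  qed
  with D show "(\<phi> has_derivative (\<lambda>v. grad \<phi> x \<bullet> v)) (at x)"
    by (metis (no_types, lifting) has_derivative_eq_rhs ext)
  show "continuous_on UNIV (grad \<phi>)"
    unfolding grad_def using cont by (intro continuous_on_vec_lambda) 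
qed

lemma C_1_borel_measurable:
  fixes \<phi> :: "real^'n::finite \<Rightarrow> real"
  assumes "C_k 1 \<phi>"
  shows "\<phi> \<in> borel_measurable borel"
  using has_derivative_continuous[OF C_1_has_derivative[OF assms]]
  by (intro borel_measurable_continuous_onI continuous_at_imp_continuous_on) auto

lemma C_1_lipschitz_on_cball:
  fixes \<phi> :: "real^'n::finite \<Rightarrow> real"
  assumes "C_k 1 \<phi>"
  obtains M where "M-lipschitz_on (cball 0 r) \<phi>"
proof -
  have "bounded (grad \<phi> ` cball 0 r)"
    using continuous_on_subset[OF C_1_continuous_grad[OF assms]]
    by (intro compact_imp_bounded compact_continuous_image) auto
  then obtain M where M: "0 < M" "\<And>x. x \<in> cball 0 r \<Longrightarrow> norm (grad \<phi> x) \<le> M"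
    unfolding bounded_pos by auto
  have "M-lipschitz_on (cball 0 r) \<phi>"
  proof (rule bounded_derivative_imp_lipschitz)
    fix x :: "real^'n" assume "x \<in> cball 0 r"
    show "(\<phi> has_derivative (\<lambda>v. grad \<phi> x \<bullet> v)) (at x within cball 0 r)"
      by (rule has_derivative_at_withinI[OF C_1_has_derivative[OF assms]])
    show "onorm (\<lambda>v. grad \<phi> x \<bullet> v) \<le> M"
    proof (rule onorm_bound)
      show "norm (grad \<phi> x \<bullet> v) \<le> M * norm v" for v
        using Cauchy_Schwarz_ineq2[of "grad \<phi> x" v] M(2)[OF \<open>x \<in> cball 0 r\<close>]
          mult_right_mono[of "norm (grad \<phi> x)" M "norm v"] by simp
    qed (use M in simp)
  qed (use M in auto)
  then show ?thesis by (rule that)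
qed

text \<open>
  The derivative of \<open>\<phi> (t x)\<close> at \<open>t = 1\<close> is \<open>grad \<phi> x \<bullet> x\<close>. The identity says that
  \<open>\<bar>x\<bar> powr p x\<close> has distributional divergence \<open>(p + d) \<bar>x\<bar> powr p\<close> on the unit ball.
\<close>

lemma integral_norm_powr_grad_test_function:
  fixes \<phi> :: "real^'n::finite \<Rightarrow> real"
  assumes p: "- real CARD('n) < p" and \<phi>: "\<phi> \<in> test_functions (ball 0 1)"
  shows "(\<integral>x. indicator (ball 0 1) x * (norm x powr p * (grad \<phi> x \<bullet> x)) \<partial>lborel)
       = - (p + real CARD('n)) * (\<integral>x. indicator (ball 0 1) x * (norm x powr p * \<phi> x) \<partial>lborel)"
proof -
  have C1: "C_k 1 \<phi>" and supp: "closure {x. \<phi> x \<noteq> 0} \<subseteq> ball 0 1"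
    using \<phi> by (auto simp: test_functions_def)
  obtain M where lip: "M-lipschitz_on (cball 0 2) \<phi>"
    using C_1_lipschitz_on_cball[OF C1] .
  have meas: "\<phi> \<in> borel_measurable borel"
    by (rule C_1_borel_measurable[OF C1])
  have zero: "\<phi> x = 0" if "1 \<le> norm x" for x
    using supp closure_subset[of "{x. \<phi> x \<noteq> 0}"] that by fastforce
  have D: "((\<lambda>t. \<phi> (t *\<^sub>R x)) has_real_derivative (grad \<phi> x \<bullet> x)) (at 1)" for x
  proof -
    have "((\<lambda>t. \<phi> (t *\<^sub>R x)) has_derivative (\<lambda>h. grad \<phi> (1 *\<^sub>R x) \<bullet> (h *\<^sub>R x))) (at 1)"
      by (rule has_derivative_compose[OF _ C_1_has_derivative[OF C1]])
        (auto intro!: derivative_eq_intros)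
    then show ?thesis
      by (simp add: has_field_derivative_def mult.commute[of _ "grad \<phi> x \<bullet> x"])
  qed
  show ?thesis
    using integral_norm_powr_radial_derivative[OF _ meas lip zero D] p by simp
qed

section \<open>The vector field\<close>

lemma integral_lebesgue_on_borel:
  fixes f :: "'a::euclidean_space \<Rightarrow> real"
  assumes [measurable]: "f \<in> borel_measurable borel" "S \<in> sets borel"
  shows "integral\<^sup>L (lebesgue_on S) f = (\<integral>x. indicator S x * f x \<partial>lborel)"
    and "integrable (lebesgue_on S) f \<longleftrightarrow> integrable lborel (\<lambda>x. indicator S x * f x)"
  by (simp_all add: integral_restrict_space integrable_restrict_space
      integral_completion integrable_completion)

theorem proposition2p8:
  assumes "CARD('n::finite) \<ge> 2"
  shows "\<exists>c::real. c > 0 \<and>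
    (\<forall>\<epsilon>::real. \<epsilon> > 0 \<longrightarrow>
      (\<exists>V \<in> Lp_fields (real CARD('n) / (real CARD('n) - 1)) (ball (0 :: real^'n) 1).
        \<exists>divV :: real^'n \<Rightarrow> real.
          has_distr_div V divV (ball 0 1) \<and>
          integrable (lebesgue_on (ball 0 1)) divV \<and>
          (AE x in lebesgue_on (ball 0 1). divV x \<ge> 0) \<and>
          (\<forall>\<delta>::real. 0 < \<delta> \<and> \<delta> < 1 \<longrightarrow>
             integral\<^sup>L (lebesgue_on (ball 0 \<delta>)) divV = c * \<delta> powr \<epsilon>)))"
proof (intro exI[of _ "1::real"] conjI allI impI)
  fix \<epsilon> :: real
  assume \<epsilon>: "0 < \<epsilon>"
  define d where "d = real CARD('n)"
  define q where "q = d / (d - 1)"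
  define p where "p = \<epsilon> - d"
  define F where "F = (\<integral>x. indicator (ball (0::real^'n) 1) x * norm x powr p \<partial>lborel)"
  define V where "V x = (norm x powr p / (\<epsilon> * F)) *\<^sub>R x" for x :: "real^'n"
  define divV where "divV x = norm x powr p / F" for x :: "real^'n"
  have d: "2 \<le> d" using assms by (simp add: d_def)
  have p: "- d < p" using \<epsilon> by (simp add: p_def)
  have F: "0 < F"
    unfolding F_def using p by (intro integral_norm_powr_unit_ball_pos) (simp add: d_def)
  have [measurable]: "V \<in> borel_measurable borel" "divV \<in> borel_measurable borel"
    unfolding V_def[abs_def] divV_def[abs_def] by simp_all

  \<comment> \<open>The exponent of \<open>\<bar>x\<bar>\<close> in \<open>\<bar>V\<bar> powr q\<close> exceeds the critical value \<open>- d\<close> by exactly \<open>\<epsilon> q\<close>.\<close>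
  have "V \<in> Lp_fields q (ball 0 1)"
  proof -
    have "(p + 1) * q = - d + \<epsilon> * q"
      using d by (simp add: p_def q_def field_simps)
    moreover have "0 < \<epsilon> * q"
      using d \<epsilon> by (simp add: q_def)
    ultimately have exponent: "- d < (p + 1) * q" by linarith
    have "norm (V x) = inverse (\<epsilon> * F) * norm x powr (p + 1)" for x
      using \<epsilon> F by (cases "x = 0") (auto simp: V_def powr_add divide_inverse)
    then have "norm (V x) powr q = inverse (\<epsilon> * F) powr q * norm x powr ((p + 1) * q)" for x
      using \<epsilon> F by (simp add: powr_mult powr_powr)
    moreover have "integrable lborel (\<lambda>x::real^'n. inverse (\<epsilon> * F) powr q *
        (indicator (ball 0 1) x * norm x powr ((p + 1) * q)))"
      using exponent by (intro integrable_mult_right integrable_norm_powr_unit_ball) (simp add: d_def)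
    ultimately have "integrable (lebesgue_on (ball 0 1)) (\<lambda>x. norm (V x) powr q)"
      by (subst integral_lebesgue_on_borel) (simp_all add: mult.left_commute)
    moreover have "V \<in> borel_measurable (lebesgue_on (ball 0 1))"
      by (intro measurable_restrict_space1 measurable_completion) simp
    ultimately show ?thesis by (simp add: Lp_fields_def)
  qed
  moreover have "has_distr_div V divV (ball 0 1)"
    unfolding has_distr_div_def
  proof
    fix \<phi> :: "real^'n \<Rightarrow> real" assume \<phi>: "\<phi> \<in> test_functions (ball 0 1)"
    then have C1: "C_k 1 \<phi>" by (simp add: test_functions_def)
    have [measurable]: "grad \<phi> \<in> borel_measurable borel"
      by (rule borel_measurable_continuous_onI[OF C_1_continuous_grad[OF C1]])
    have [measurable]: "\<phi> \<in> borel_measurable borel"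
      by (rule C_1_borel_measurable[OF C1])
    let ?I = "\<integral>x. indicator (ball 0 1) x * (norm x powr p * \<phi> x) \<partial>lborel"
    have "distr_div (ball 0 1) V \<phi>
        = - (\<integral>x. indicator (ball 0 1) x * (norm x powr p * (grad \<phi> x \<bullet> x)) / (\<epsilon> * F) \<partial>lborel)"
      unfolding distr_div_def by (subst integral_lebesgue_on_borel)
        (simp_all add: V_def inner_commute)
    also have "\<dots> = \<epsilon> * ?I / (\<epsilon> * F)"
      using integral_norm_powr_grad_test_function[of p \<phi>] p \<phi> by (simp add: d_def p_def)
    also have "\<dots> = ?I / F" using \<epsilon> by simp
    also have "\<dots> = (\<integral>x. indicator (ball 0 1) x * (norm x powr p * \<phi> x) / F \<partial>lborel)"
      by simp
    also have "\<dots> = integral\<^sup>L (lebesgue_on (ball 0 1)) (\<lambda>x. divV x * \<phi> x)"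
      by (subst integral_lebesgue_on_borel) (simp_all add: divV_def)
    finally show "distr_div (ball 0 1) V \<phi> = integral\<^sup>L (lebesgue_on (ball 0 1)) (\<lambda>x. divV x * \<phi> x)" .
  qed
  moreover have "integrable (lebesgue_on (ball 0 1)) divV"
    using integrable_divide[OF integrable_norm_powr_unit_ball[of p, where 'a = "real^'n"], of F] p
    by (subst integral_lebesgue_on_borel) (simp_all add: divV_def d_def)
  moreover have "AE x in lebesgue_on (ball 0 1). 0 \<le> divV x"
    using F by (simp add: divV_def)
  moreover have "integral\<^sup>L (lebesgue_on (ball 0 \<delta>)) divV = 1 * \<delta> powr \<epsilon>" if "0 < \<delta> \<and> \<delta> < 1" for \<delta>
    using integral_norm_powr_ball[of \<delta> p, where 'a = "real^'n"] that F
    by (subst integral_lebesgue_on_borel) (simp_all add: divV_def p_def d_def F_def)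
  ultimately show "\<exists>V \<in> Lp_fields (real CARD('n) / (real CARD('n) - 1)) (ball (0 :: real^'n) 1).
        \<exists>divV :: real^'n \<Rightarrow> real.
          has_distr_div V divV (ball 0 1) \<and>
          integrable (lebesgue_on (ball 0 1)) divV \<and>
          (AE x in lebesgue_on (ball 0 1). divV x \<ge> 0) \<and>
          (\<forall>\<delta>::real. 0 < \<delta> \<and> \<delta> < 1 \<longrightarrow>
             integral\<^sup>L (lebesgue_on (ball 0 \<delta>)) divV = 1 * \<delta> powr \<epsilon>)"
    unfolding q_def d_def by blast
qed simp

end
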